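(* Let $\{X_{k,n},\ 1\le k\le k(n)\}_{n\ge1}$ be an array of real-valued square integrable random variables, with $k(n)\to+\infty$, such that for each $n$ the variables $X_{1,n},\dots,X_{k(n),n}$ are independent, and put $S_n=X_{1,n}+\cdots+X_{k(n),n}$. Let $a_{k,n}=\mathbb EX_{k,n}$, $\sigma^2_{k,n}=\mathrm{Var}(X_{k,n})$, and let $F^*_{k,n}$ be the cumulative distribution function of $X_{k,n}-a_{k,n}$. For $\varepsilon>0$ and $n\ge1$ let $$g_{n,pois}(\varepsilon)=\sum_{k=1}^{k(n)}\int_{|x-1|>\varepsilon}x^2\,dF^*_{k,n}(x).$$ Let $\lambda>0$ and suppose that, as $n\to+\infty$, $$\max_{1\le k\le k(n)}\sigma^2_{k,n}\to0\qquad\text{and}\qquad\sum_{1\le k\le k(n)}\sigma^2_{k,n}\to\lambda .$$ Let $b\in\mathbb R$. Then $$S_n\rightsquigarrow\mathcal P(b,\lambda)\ \text{ as } n\to+\infty$$ if and only if $$\sum_{k=1}^{k(n)}\mathbb E(X_{k,n})\to b+\lambda\ \text{ as } n\to+\infty$$ and, for every $\varepsilon>0$, $g_{n,pois}(\varepsilon)\to0$ as $n\to+\infty$.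
   Context: $\rightsquigarrow$ denotes convergence in distribution. $\mathcal P(b,\lambda)$ is the translated Poisson law, i.e. the law of $b+N$ with $N$ Poisson of parameter $\lambda$; its characteristic function is $u\mapsto\exp(ibu+\lambda(e^{iu}-1))$. *)

theory Defs
  imports "HOL-Probability.Probability"
begin

text \<open>The law of \<open>b + N\<close> for \<open>N\<close> Poisson distributed with parameter \<open>lam\<close>; meaningful for \<open>0 < lam\<close> only.\<close>

definition translated_poisson :: "real \<Rightarrow> real \<Rightarrow> real measure" where
  "translated_poisson b lam = distr (measure_pmf (poisson_pmf lam)) borel (\<lambda>j. b + real j)"

lemma char_translated_poisson:
  assumes "0 < lam"
  shows "char (translated_poisson b lam) u = exp (\<i> * b * u + lam * (exp (\<i> * u) - 1))"
proof -
  have "char (translated_poisson b lam) u = (LINT j|measure_pmf (poisson_pmf lam). iexp (u * (b + real j)))"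
    unfolding char_def translated_poisson_def by (subst integral_distr) auto
  also have "\<dots> = (LINT j|count_space UNIV. pmf (poisson_pmf lam) j *\<^sub>R iexp (u * (b + real j)))"
    by (subst measure_pmf_eq_density) (subst integral_density; simp)
  also have "\<dots> = (\<Sum>j. pmf (poisson_pmf lam) j *\<^sub>R iexp (u * (b + real j)))"
  proof (rule integral_count_space_nat)
    have "integrable (count_space UNIV) (\<lambda>j. pmf (poisson_pmf lam) j)"
      by (rule integrable_pmf)
    then show "integrable (count_space UNIV) (\<lambda>j. pmf (poisson_pmf lam) j *\<^sub>R iexp (u * (b + real j)))"
      by (rule Bochner_Integration.integrable_bound) auto
  qed
  also have "\<dots> = exp (\<i> * b * u + lam * (exp (\<i> * u) - 1))"
  proof (rule sums_unique[symmetric])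
    have "(\<lambda>j. (lam * exp (\<i> * u)) ^ j /\<^sub>R fact j) sums exp (lam * exp (\<i> * u))"
      by (rule exp_converges)
    then have "(\<lambda>j. exp (\<i> * b * u - lam) * ((lam * exp (\<i> * u)) ^ j /\<^sub>R fact j))
        sums (exp (\<i> * b * u - lam) * exp (lam * exp (\<i> * u)))"
      by (rule sums_mult)
    moreover have "exp (\<i> * b * u - lam) * ((lam * exp (\<i> * u)) ^ j /\<^sub>R fact j) =
        pmf (poisson_pmf lam) j *\<^sub>R iexp (u * (b + real j))" for j
    proof -
      have "iexp (u * (b + real j)) = exp (\<i> * b * u) * exp (\<i> * u) ^ j"
        by (simp add: exp_of_nat_mult[symmetric] exp_add[symmetric] algebra_simps)
      moreover have "exp (\<i> * b * u - lam) = exp (\<i> * b * u) * of_real (exp (- lam))"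
        by (simp add: exp_diff exp_minus exp_of_real[symmetric] field_simps)
      ultimately show ?thesis
        using assms by (simp add: scaleR_conv_of_real power_mult_distrib field_simps)
    qed
    moreover have "exp (\<i> * b * u - lam) * exp (lam * exp (\<i> * u)) = exp (\<i> * b * u + lam * (exp (\<i> * u) - 1))"
      by (simp add: exp_add[symmetric] algebra_simps)
    ultimately show "(\<lambda>j. pmf (poisson_pmf lam) j *\<^sub>R iexp (u * (b + real j)))
        sums exp (\<i> * b * u + lam * (exp (\<i> * u) - 1))"
      by simp
  qed
  finally show ?thesis .
qed

definition centered_cdf :: "'a measure \<Rightarrow> ('a \<Rightarrow> real) \<Rightarrow> real \<Rightarrow> real" where
  "centered_cdf M Y = cdf (distr M borel (\<lambda>\<omega>. Y \<omega> - prob_space.expectation M Y))"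

text \<open>The integral against \<open>dF\<close> is the Lebesgue--Stieltjes integral, i.e. the integral with
  respect to \<open>interval_measure F\<close>. Row \<open>n\<close> of the array consists of \<open>X k n\<close> for
  \<open>1 \<le> k \<le> kn n\<close> and lives on the space \<open>M n\<close>.\<close>

definition g_pois ::
  "(nat \<Rightarrow> 'a measure) \<Rightarrow> (nat \<Rightarrow> nat \<Rightarrow> 'a \<Rightarrow> real) \<Rightarrow> (nat \<Rightarrow> nat) \<Rightarrow> nat \<Rightarrow> real \<Rightarrow> real" where
  "g_pois M X kn n \<epsilon> =
    (\<Sum>k=1..kn n. LINT x:{x. \<bar>x - 1\<bar> > \<epsilon>}|interval_measure (centered_cdf (M n) (X k n)). x\<^sup>2)"

end

theory Submission
  imports Defs
begin

text \<open>
  Write \<open>\<nu>\<^sub>k\<close> for the law of the centred variable \<open>X\<^sub>k - a\<^sub>k\<close>, \<open>A = \<Sum>\<^sub>k a\<^sub>k\<close>, and let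
  \<open>K(dx) = \<Sum>\<^sub>k x\<^sup>2 \<nu>\<^sub>k(dx)\<close>, a measure whose total mass tends to \<open>\<lambda>\<close>. The second condition says that
  \<open>K\<close> concentrates at the point \<open>1\<close>.

  Because the variances are uniformly small, the characteristic function of the row sum is, up to
  \<open>o(1)\<close>, the exponential of \<open>\<i>uA + \<Psi>(u)\<close> with \<open>\<Psi>(u) = \<Sum>\<^sub>k (char \<nu>\<^sub>k u - 1)\<close>
  (\<open>prod_char_minus_exp_log_char\<close>). Centring gives \<open>\<Psi>(u) = \<integral> e\<^sub>u(x) / x\<^sup>2 K(dx)\<close> for the
  compensated exponential \<open>e\<^sub>u(x) = exp(\<i>ux) - 1 - \<i>ux\<close>, which is \<open>O(x\<^sup>2)\<close>. The characteristic
  function of the translated Poisson law is the exponential of \<open>\<i>u(b + \<lambda>) + \<lambda> e\<^sub>u(1)\<close>.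

  If \<open>K\<close> concentrates at \<open>1\<close>, then \<open>\<Psi>(u) \<longlonglongrightarrow> \<lambda> e\<^sub>u(1)\<close>, since \<open>e\<^sub>u(x) / x\<^sup>2\<close> is bounded and
  continuous at \<open>1\<close> (\<open>log_char_tendsto_poisson\<close>); with \<open>A \<longlonglongrightarrow> b + \<lambda>\<close>, Levy's continuity theorem
  gives the convergence in law.

  Conversely, convergence in law makes the row sums tight, and their variances are bounded, so \<open>A\<close> is
  bounded (\<open>weak_conv_imp_centering_bounded\<close>). For small \<open>u\<close> the difference
  \<open>\<i>u(A - b - \<lambda>) + \<Psi>(u) - \<lambda> e\<^sub>u(1)\<close> then stays in a disc on which the exponential is injective,
  so it tends to \<open>0\<close> along with its exponential tending to \<open>1\<close>. Its second part is \<open>O(u\<^sup>2)\<close>, so letting \<open>u\<close> tend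
  to \<open>0\<close> separates the two parts: \<open>A \<longlonglongrightarrow> b + \<lambda>\<close> and \<open>\<Psi>(u) \<longlonglongrightarrow> \<lambda> e\<^sub>u(1)\<close> for all small \<open>u\<close>
  (\<open>exp_limit_imp_exponent_limit\<close>).

  It remains to read off the concentration of \<open>K\<close> from \<open>\<Psi>\<close> near \<open>0\<close> (\<open>off_one_tendsto_zero\<close>). For
  every small \<open>h\<close>, off an \<open>\<epsilon>\<close>-neighbourhood of \<open>1\<close>,
  \<open>x\<^sup>2 \<le> 2 (x\<^sup>2 - 2 (1 - cos hx) / h\<^sup>2) + c (1 - cos hx) (1 - cos (h(x - 1)/2))\<close>
  with \<open>c\<close> depending on \<open>h\<close> and \<open>\<epsilon>\<close> (\<open>square_le_trig_test_functions\<close>). Both summands are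
  nonnegative everywhere, and their sums over the row are functions of the total mass of \<open>K\<close> and of
  finitely many values of \<open>\<Psi>\<close>. Hence they have the limits that a mass \<open>\<lambda>\<close> at \<open>1\<close> would give: for the
  second summand this is \<open>0\<close>, for the first at most \<open>\<lambda> h\<^sup>2 / 6\<close>, which is arbitrarily small.
\<close>

section \<open>Elementary estimates for the exponential and the cosine\<close>

lemma norm_exp_minus_linear_le:
  fixes z :: complex
  assumes "norm z \<le> 1"
  shows "norm (exp z - 1 - z) \<le> 3 * (norm z)\<^sup>2"
proof -
  have "norm (exp z - 1 - z) \<le> exp \<bar>Re z\<bar> * (norm z)\<^sup>2"
    using Taylor_exp[of z 1] by (simp add: algebra_simps power2_eq_square)
  also have "\<dots> \<le> exp 1 * (norm z)\<^sup>2"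
    using abs_Re_le_cmod[of z] assms by (intro mult_right_mono) auto
  also have "\<dots> \<le> 3 * (norm z)\<^sup>2"
    using exp_le by (intro mult_right_mono) auto
  finally show ?thesis .
qed

text \<open>On the disc of radius \<open>1/6\<close> the quadratic error \<open>3 |z|\<^sup>2\<close> is at most half of \<open>|z|\<close>, so
  \<open>|exp z - 1| \<ge> |z| / 2\<close> there: no multiple of \<open>2\<pi>\<i>\<close> can interfere with taking logarithms.\<close>

lemma tendsto_zero_if_exp_tendsto_one:
  fixes D :: "nat \<Rightarrow> complex"
  assumes small: "\<forall>\<^sub>F n in sequentially. norm (D n) \<le> 1/6"
    and lim: "(\<lambda>n. exp (D n)) \<longlonglongrightarrow> 1"
  shows "D \<longlonglongrightarrow> 0"
proof (rule Lim_null_comparison)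
  have bound: "norm z \<le> 2 * norm (exp z - 1)" if "norm z \<le> 1/6" for z :: complex
  proof -
    have "norm z \<le> norm (exp z - 1) + norm (exp z - 1 - z)"
      using norm_triangle_ineq4[of "exp z - 1" "exp z - 1 - z"] by simp
    also have "norm (exp z - 1 - z) \<le> 3 * (norm z)\<^sup>2"
      using that by (intro norm_exp_minus_linear_le) simp
    also have "3 * (norm z)\<^sup>2 \<le> norm z / 2"
      using mult_right_mono[OF that, of "norm z"] by (simp add: power2_eq_square)
    finally show ?thesis by simp
  qed
  show "\<forall>\<^sub>F n in sequentially. norm (D n) \<le> 2 * norm (exp (D n) - 1)"
    using small by eventually_elim (rule bound)
  have "(\<lambda>n. 2 * norm (exp (D n) - 1)) \<longlonglongrightarrow> 2 * norm ((1::complex) - 1)"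
    by (intro tendsto_intros lim)
  then show "(\<lambda>n. 2 * norm (exp (D n) - 1)) \<longlonglongrightarrow> 0" by simp
qed

text \<open>The lower bound \<open>y\<^sup>2 / 8\<close> on \<open>[-3, 3]\<close> is what makes \<open>1 - cos y\<close> usable as a detector of
  \<open>y \<noteq> 0\<close>; it comes from the fourth-order expansion, since \<open>y\<^sup>4 / 24 \<le> 3 y\<^sup>2 / 8\<close> there.\<close>

lemma one_minus_cos_bounds:
  fixes y :: real
  shows "y\<^sup>2 / 2 - y ^ 4 / 24 \<le> 1 - cos y" and "1 - cos y \<le> y\<^sup>2 / 2"
    and "\<bar>y\<bar> \<le> 3 \<Longrightarrow> y\<^sup>2 / 8 \<le> 1 - cos y"
proof -
  have "Re (iexp y - (\<Sum>k\<le>3. (\<i> * y) ^ k / fact k)) = cos y - 1 + y\<^sup>2 / 2"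
    by (simp add: numeral_3_eq_3 power2_eq_square fact_numeral Re_exp)
  then have "\<bar>cos y - 1 + y\<^sup>2 / 2\<bar> \<le> y ^ 4 / 24"
    using iexp_approx1[of y 3] abs_Re_le_cmod[of "iexp y - (\<Sum>k\<le>3. (\<i> * y) ^ k / fact k)"]
    by (simp add: fact_numeral)
  then show *: "y\<^sup>2 / 2 - y ^ 4 / 24 \<le> 1 - cos y" by linarith
  show "1 - cos y \<le> y\<^sup>2 / 2"
    using cos_double_sin[of "y/2"] abs_sin_x_le_abs_x[of "y/2"]
      power_mono[of "\<bar>sin (y/2)\<bar>" "\<bar>y/2\<bar>" 2] by (simp add: power_divide)
  assume "\<bar>y\<bar> \<le> 3"
  then have "y\<^sup>2 \<le> 9" using power_mono[of "\<bar>y\<bar>" 3 2] by simp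
  then have "y\<^sup>2 * y\<^sup>2 \<le> 9 * y\<^sup>2" by (intro mult_right_mono) auto
  then have "y ^ 4 \<le> 9 * y\<^sup>2" by (simp add: power2_eq_square power4_eq_xxxx mult.assoc)
  with * show "y\<^sup>2 / 8 \<le> 1 - cos y" by simp
qed

text \<open>
  The first bracket handles large \<open>x\<close>: for \<open>|hx| > 3\<close> the bounded term \<open>2 (1 - cos hx) / h\<^sup>2\<close> eats
  at most half of \<open>x\<^sup>2\<close>. For \<open>|hx| \<le> 3\<close> the product handles all \<open>x\<close> away from \<open>1\<close>: its first factor is
  comparable to \<open>x\<^sup>2\<close>, and its second factor, of half the frequency, vanishes only at \<open>x = 1\<close>,
  because \<open>h \<le> 1\<close> keeps \<open>h(x - 1)/2\<close> within \<open>[-3, 3]\<close> too.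
\<close>

lemma square_le_trig_test_functions:
  fixes x h \<epsilon> :: real
  assumes h: "0 < h" "h \<le> 1" and \<epsilon>: "0 < \<epsilon>" "\<epsilon> < \<bar>x - 1\<bar>"
  shows "x\<^sup>2 \<le> 2 * (x\<^sup>2 - 2 / h\<^sup>2 * (1 - cos (h * x)))
    + 256 / (h ^ 4 * \<epsilon>\<^sup>2) * ((1 - cos (h * x)) * (1 - cos (h / 2 * (x - 1))))"
proof -
  have tail_nonneg: "0 \<le> x\<^sup>2 - 2 / h\<^sup>2 * (1 - cos (h * x))"
    using one_minus_cos_bounds(2)[of "h * x"] h by (simp add: field_simps power_mult_distrib)
  have local_nonneg: "0 \<le> (1 - cos (h * x)) * (1 - cos (h / 2 * (x - 1)))"
    by simp
  show ?thesis
  proof (cases "\<bar>h * x\<bar> \<le> 3")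
    case True
    have "\<bar>h / 2 * (x - 1)\<bar> \<le> 3"
      using True h by (auto simp: abs_le_iff algebra_simps)
    then have "(h / 2 * (x - 1))\<^sup>2 / 8 \<le> 1 - cos (h / 2 * (x - 1))"
      by (rule one_minus_cos_bounds(3))
    moreover have "\<epsilon>\<^sup>2 \<le> (x - 1)\<^sup>2"
      using power_mono[of \<epsilon> "\<bar>x - 1\<bar>" 2] \<epsilon> by simp
    ultimately have "h\<^sup>2 * \<epsilon>\<^sup>2 / 32 \<le> 1 - cos (h / 2 * (x - 1))"
      using mult_left_mono[of "\<epsilon>\<^sup>2" "(x - 1)\<^sup>2" "h\<^sup>2"] by (simp add: power_mult_distrib power_divide)
    moreover have "(h * x)\<^sup>2 / 8 \<le> 1 - cos (h * x)"
      using True by (rule one_minus_cos_bounds(3))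
    ultimately have "(h * x)\<^sup>2 / 8 * (h\<^sup>2 * \<epsilon>\<^sup>2 / 32) \<le> (1 - cos (h * x)) * (1 - cos (h / 2 * (x - 1)))"
      by (intro mult_mono) auto
    then have "256 / (h ^ 4 * \<epsilon>\<^sup>2) * ((h * x)\<^sup>2 / 8 * (h\<^sup>2 * \<epsilon>\<^sup>2 / 32))
        \<le> 256 / (h ^ 4 * \<epsilon>\<^sup>2) * ((1 - cos (h * x)) * (1 - cos (h / 2 * (x - 1))))"
      by (intro mult_left_mono) auto
    moreover have "256 / (h ^ 4 * \<epsilon>\<^sup>2) * ((h * x)\<^sup>2 / 8 * (h\<^sup>2 * \<epsilon>\<^sup>2 / 32)) = x\<^sup>2"
      using h \<epsilon> by (simp add: field_simps power2_eq_square power4_eq_xxxx)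
    ultimately have "x\<^sup>2 \<le> 256 / (h ^ 4 * \<epsilon>\<^sup>2) * ((1 - cos (h * x)) * (1 - cos (h / 2 * (x - 1))))"
      by (simp only:)
    with tail_nonneg show ?thesis by (intro add_increasing mult_nonneg_nonneg) auto
  next
    case False
    then have "3\<^sup>2 \<le> \<bar>h * x\<bar>\<^sup>2" by (intro power_mono) auto
    then have "8 \<le> h\<^sup>2 * x\<^sup>2" by (simp add: power_mult_distrib)
    moreover have "4 * (1 - c) \<le> 8" if "- 1 \<le> c" for c :: real using that by simp
    then have "4 * (1 - cos (h * x)) \<le> 8" using cos_ge_minus_one by blast
    ultimately have "4 * (1 - cos (h * x)) \<le> h\<^sup>2 * x\<^sup>2" by linarith
    then have "x\<^sup>2 \<le> 2 * (x\<^sup>2 - 2 / h\<^sup>2 * (1 - cos (h * x)))"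
      using h by (simp add: field_simps)
    moreover have "0 \<le> 256 / (h ^ 4 * \<epsilon>\<^sup>2) * ((1 - cos (h * x)) * (1 - cos (h / 2 * (x - 1))))"
      using local_nonneg h \<epsilon> by simp
    ultimately show ?thesis by (intro add_increasing2)
  qed
qed

section \<open>The compensated exponential\<close>

text \<open>The integrand of the Levy--Khinchin formula for laws of finite variance.\<close>

definition compensated_exp :: "real \<Rightarrow> real \<Rightarrow> complex" where
  "compensated_exp u x = iexp (u * x) - 1 - \<i> * (u * x)"

lemma norm_compensated_exp_le: "norm (compensated_exp u x) \<le> u\<^sup>2 * x\<^sup>2 / 2"
  using iexp_approx1[of "u * x" 1] by (simp add: compensated_exp_def algebra_simps power2_eq_square)

text \<open>Continuity at \<open>1\<close> of the quotient by \<open>x\<^sup>2\<close>, in a form without division.\<close>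

lemma compensated_exp_near_one:
  assumes "0 < \<eta>"
  obtains d where "0 < d"
    "\<And>x. \<bar>x - 1\<bar> \<le> d \<Longrightarrow> norm (compensated_exp u x - x\<^sup>2 * compensated_exp u 1) \<le> \<eta> * x\<^sup>2"
proof -
  let ?f = "\<lambda>x. norm (compensated_exp u x - x\<^sup>2 * compensated_exp u 1)"
  have "isCont ?f 1"
    unfolding compensated_exp_def by (intro continuous_intros)
  then obtain d where d: "d > 0" "\<And>x. dist x 1 < d \<Longrightarrow> dist (?f x) (?f 1) < \<eta> / 4"
    using assms unfolding continuous_at_eps_delta
    by (metis (no_types, lifting) dist_commute zero_less_divide_iff zero_less_numeral)
  show thesis
  proof (rule that[of "min (d / 2) (1 / 2)"])
    show "0 < min (d / 2) (1 / 2)" using d(1) by simp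
    fix x :: real assume x: "\<bar>x - 1\<bar> \<le> min (d / 2) (1 / 2)"
    then have "dist x 1 < d" using d(1) by (simp add: dist_real_def)
    from d(2)[OF this] have "?f x < \<eta> / 4" by (simp add: dist_real_def)
    also have "\<eta> / 4 \<le> \<eta> * x\<^sup>2"
    proof -
      have "1 / 2 \<le> x" using x by linarith
      then have "(1 / 2)\<^sup>2 \<le> x\<^sup>2" by (intro power_mono) auto
      then show ?thesis using mult_left_mono[of "1/4" "x\<^sup>2" \<eta>] assms by (simp add: power2_eq_square)
    qed
    finally show "?f x \<le> \<eta> * x\<^sup>2" by simp
  qed
qed

section \<open>Laws on the real line and their characteristic functions\<close>

context real_distribution
begin

lemma prob_UNIV: "prob UNIV = 1"
  using prob_space by simp

lemma integrable_iexp_mult: "integrable M (\<lambda>x. iexp (u * x))"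
  by (rule integrable_const_bound[where B = 1]) auto

text \<open>
  The right-hand sides only involve the differences \<open>char M v - 1\<close>, so they can be summed over a
  row whose number of terms is unbounded. In the second one they enter through second differences with step \<open>h\<close>,
  at \<open>0\<close> and at \<open>u\<close>; this is multiplication by \<open>1 - cos hx\<close> on the Fourier side.
\<close>

lemma
  shows integral_one_minus_cos: "(LINT x|M. 1 - cos (h * x)) = - Re (char M h - 1)"
    and integral_localized_test: "(LINT x|M. (1 - cos (h * x)) * (1 - cos (u * (x - 1)))) =
      Re (- ((char M h - 1) + (char M (- h) - 1)) / 2
        + exp (- \<i> * u) * ((char M (u + h) - 1) + (char M (u - h) - 1) - 2 * (char M u - 1)) / 2)"
proof -
  have "(LINT x|M. 1 - cos (h * x)) = (LINT x|M. Re (1 - iexp (h * x)))"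
    by (simp add: Re_exp)
  also have "\<dots> = - Re (char M h - 1)"
    using integrable_iexp_mult by (subst integral_Re) (auto simp: char_def prob_UNIV)
  finally show "(LINT x|M. 1 - cos (h * x)) = - Re (char M h - 1)" .
  let ?E = "\<lambda>v x. iexp (v * x)"
  let ?F = "\<lambda>x. - ((?E h x - 1) + (?E (- h) x - 1)) / 2
      + exp (- \<i> * u) * ((?E (u + h) x - 1) + (?E (u - h) x - 1) - 2 * (?E u x - 1)) / 2"
  have F: "(1 - cos (h * x)) * (1 - cos (u * (x - 1))) = Re (?F x)" for x
  proof -
    have factor: "- ((p - 1) + (q - 1)) / 2 + w * ((e * p - 1) + (e * q - 1) - 2 * (e - 1)) / 2
        = (1 - (p + q) / 2) * (1 - w * e)" for p q w e :: complex
      by (simp add: field_simps)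
    have "(?E h x + ?E (- h) x) / 2 = complex_of_real (cos (h * x))"
      by (simp add: complex_eq_iff Re_exp Im_exp)
    moreover have "?E (u + h) x = ?E u x * ?E h x" "?E (u - h) x = ?E u x * ?E (- h) x"
      by (simp_all add: exp_add[symmetric] algebra_simps)
    ultimately have "?F x = complex_of_real (1 - cos (h * x)) * (1 - exp (- \<i> * u) * ?E u x)"
      by (simp only: factor of_real_diff of_real_1)
    also have "exp (- \<i> * u) * ?E u x = iexp (u * (x - 1))"
      by (simp add: exp_add[symmetric] algebra_simps)
    finally show ?thesis
      by (simp add: Re_exp)
  qed
  have "(LINT x|M. (1 - cos (h * x)) * (1 - cos (u * (x - 1)))) = Re (CLINT x|M. ?F x)"
    unfolding F by (intro integral_Re Bochner_Integration.integrable_add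
        Bochner_Integration.integrable_diff integrable_divide integrable_mult_right
        Bochner_Integration.integrable_minus integrable_iexp_mult) auto
  also have "(CLINT x|M. ?F x) = - ((char M h - 1) + (char M (- h) - 1)) / 2
        + exp (- \<i> * u) * ((char M (u + h) - 1) + (char M (u - h) - 1) - 2 * (char M u - 1)) / 2"
    using integrable_iexp_mult[of h] integrable_iexp_mult[of "- h"] integrable_iexp_mult[of u]
      integrable_iexp_mult[of "u + h"] integrable_iexp_mult[of "u - h"]
    unfolding char_def by (simp add: prob_UNIV)
  finally show "(LINT x|M. (1 - cos (h * x)) * (1 - cos (u * (x - 1)))) =
      Re (- ((char M h - 1) + (char M (- h) - 1)) / 2
        + exp (- \<i> * u) * ((char M (u + h) - 1) + (char M (u - h) - 1) - 2 * (char M u - 1)) / 2)" .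
qed

lemma second_moment_off_one_le:
  assumes sq: "integrable M (\<lambda>x. x\<^sup>2)" and h: "0 < h" "h \<le> 1" and \<epsilon>: "0 < \<epsilon>"
  shows "(LINT x:{x. \<bar>x - 1\<bar> > \<epsilon>}|M. x\<^sup>2) \<le>
    2 * ((LINT x|M. x\<^sup>2) - 2 / h\<^sup>2 * (LINT x|M. 1 - cos (h * x)))
    + 256 / (h ^ 4 * \<epsilon>\<^sup>2) * (LINT x|M. (1 - cos (h * x)) * (1 - cos (h / 2 * (x - 1))))"
proof -
  have trig_int1: "integrable M (\<lambda>x. 1 - cos (h * x))"
    by (rule integrable_const_bound[where B = 2])
       (auto intro!: AE_I2 simp: abs_le_iff intro: order_trans[OF cos_le_one] order_trans[OF _ cos_ge_minus_one])
  have trig_int2: "integrable M (\<lambda>x. (1 - cos (h * x)) * (1 - cos (h / 2 * (x - 1))))"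
  proof (rule integrable_const_bound[where B = "2 * 2"])
    have "\<bar>1 - cos y\<bar> \<le> 2" for y :: real
      using cos_le_one[of y] cos_ge_minus_one[of y] by linarith
    then show "AE x in M. norm ((1 - cos (h * x)) * (1 - cos (h / 2 * (x - 1)))) \<le> 2 * 2"
      unfolding real_norm_def abs_mult by (intro AE_I2 mult_mono) auto
  qed simp
  have "(LINT x:{x. \<bar>x - 1\<bar> > \<epsilon>}|M. x\<^sup>2) \<le> (LINT x|M. 2 * (x\<^sup>2 - 2 / h\<^sup>2 * (1 - cos (h * x)))
    + 256 / (h ^ 4 * \<epsilon>\<^sup>2) * ((1 - cos (h * x)) * (1 - cos (h / 2 * (x - 1)))))"
    unfolding set_lebesgue_integral_def
  proof (rule integral_mono)
    show "integrable M (\<lambda>x. indicat_real {x. \<bar>x - 1\<bar> > \<epsilon>} x *\<^sub>R x\<^sup>2)"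
      by (rule Bochner_Integration.integrable_bound[OF sq]) (auto simp: indicator_def)
    fix x :: real
    show "indicat_real {x. \<bar>x - 1\<bar> > \<epsilon>} x *\<^sub>R x\<^sup>2 \<le> 2 * (x\<^sup>2 - 2 / h\<^sup>2 * (1 - cos (h * x)))
      + 256 / (h ^ 4 * \<epsilon>\<^sup>2) * ((1 - cos (h * x)) * (1 - cos (h / 2 * (x - 1))))"
    proof (cases "\<bar>x - 1\<bar> > \<epsilon>")
      case True
      then show ?thesis using square_le_trig_test_functions[OF h \<epsilon>, of x] by simp
    next
      case False
      have "0 \<le> x\<^sup>2 - 2 / h\<^sup>2 * (1 - cos (h * x))"
        using one_minus_cos_bounds(2)[of "h * x"] h by (simp add: field_simps power_mult_distrib)
      then have "0 \<le> 2 * (x\<^sup>2 - 2 / h\<^sup>2 * (1 - cos (h * x)))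
        + 256 / (h ^ 4 * \<epsilon>\<^sup>2) * ((1 - cos (h * x)) * (1 - cos (h / 2 * (x - 1))))"
        using h \<epsilon> by (intro add_nonneg_nonneg mult_nonneg_nonneg) auto
      with False show ?thesis by simp
    qed
  qed (intro Bochner_Integration.integrable_add Bochner_Integration.integrable_diff
      integrable_mult_right sq trig_int1 trig_int2)
  also have "\<dots> = 2 * ((LINT x|M. x\<^sup>2) - 2 / h\<^sup>2 * (LINT x|M. 1 - cos (h * x)))
    + 256 / (h ^ 4 * \<epsilon>\<^sup>2) * (LINT x|M. (1 - cos (h * x)) * (1 - cos (h / 2 * (x - 1))))"
    by (simp only: integral_mult_right_zero
        Bochner_Integration.integral_diff[OF sq integrable_mult_right[OF trig_int1]]
        Bochner_Integration.integral_add[OF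
          integrable_mult_right[OF Bochner_Integration.integrable_diff[OF sq integrable_mult_right[OF trig_int1]]]
          integrable_mult_right[OF trig_int2]])
  finally show ?thesis .
qed

lemma
  assumes sq: "integrable M (\<lambda>x. x\<^sup>2)" and mean: "expectation (\<lambda>x. x) = 0"
  shows char_minus_one_eq: "char M u - 1 = (CLINT x|M. compensated_exp u x)"
    and integrable_compensated_exp: "integrable M (compensated_exp u)"
    and norm_char_minus_one_le: "norm (char M u - 1) \<le> u\<^sup>2 / 2 * (LINT x|M. x\<^sup>2)"
proof -
  have int: "integrable M (\<lambda>x. x)"
    by (rule square_integrable_imp_integrable[OF _ sq]) simp
  have lin: "integrable M (\<lambda>x. \<i> * complex_of_real (u * x))"
    using int by (intro integrable_mult_right integrable_of_real) auto
  show rem: "integrable M (compensated_exp u)"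
    unfolding compensated_exp_def by (intro Bochner_Integration.integrable_diff integrable_iexp_mult lin) simp
  have "(CLINT x|M. \<i> * complex_of_real (u * x)) = 0"
    using mean int by (simp del: of_real_mult)
  then show eq: "char M u - 1 = (CLINT x|M. compensated_exp u x)"
    unfolding compensated_exp_def char_def using integrable_iexp_mult[of u] lin
    by (simp add: prob_UNIV del: of_real_mult)
  have "norm (CLINT x|M. compensated_exp u x) \<le> (LINT x|M. norm (compensated_exp u x))"
    by (rule integral_norm_bound)
  also have "\<dots> \<le> (LINT x|M. u\<^sup>2 / 2 * x\<^sup>2)"
    using sq norm_compensated_exp_le[of u] by (intro integral_mono integrable_norm rem) (auto simp: field_simps)
  finally show "norm (char M u - 1) \<le> u\<^sup>2 / 2 * (LINT x|M. x\<^sup>2)"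
    unfolding eq by simp
qed

text \<open>
  \<open>char M u - 1\<close> is the integral of the compensated exponential, which is compared with
  \<open>x\<^sup>2\<close> times its value at \<open>1\<close>: the hypothesis controls the difference near \<open>1\<close>, and the global quadratic bound
  does so elsewhere.
\<close>

lemma char_poisson_approx:
  assumes sq: "integrable M (\<lambda>x. x\<^sup>2)" and mean: "expectation (\<lambda>x. x) = 0"
    and near: "\<And>x. \<bar>x - 1\<bar> \<le> d \<Longrightarrow> norm (compensated_exp u x - x\<^sup>2 * compensated_exp u 1) \<le> \<eta> * x\<^sup>2"
    and \<eta>: "0 \<le> \<eta>"
  shows "norm (char M u - 1 - (LINT x|M. x\<^sup>2) * compensated_exp u 1) \<le>
    \<eta> * (LINT x|M. x\<^sup>2) + u\<^sup>2 * (LINT x:{x. \<bar>x - 1\<bar> > d}|M. x\<^sup>2)"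
proof -
  let ?f = "\<lambda>x. compensated_exp u x - x\<^sup>2 * compensated_exp u 1"
  have sqc: "integrable M (\<lambda>x. complex_of_real x ^ 2 * compensated_exp u 1)"
    using integrable_of_real[OF sq, where 'a = complex] by (intro integrable_mult_left) simp
  have f: "integrable M ?f"
    by (intro Bochner_Integration.integrable_diff integrable_compensated_exp sq mean sqc)
  have ind: "integrable M (\<lambda>x. indicat_real {x. \<bar>x - 1\<bar> > d} x * x\<^sup>2)"
    by (rule Bochner_Integration.integrable_bound[OF sq]) (auto simp: indicator_def)
  have "(CLINT x|M. ?f x) = (CLINT x|M. compensated_exp u x) - (CLINT x|M. (complex_of_real x)\<^sup>2) * compensated_exp u 1"
    using integrable_compensated_exp[OF sq mean, of u] sqc
    by (subst Bochner_Integration.integral_diff) auto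
  then have "char M u - 1 - (LINT x|M. x\<^sup>2) * compensated_exp u 1 = (CLINT x|M. ?f x)"
    unfolding char_minus_one_eq[OF sq mean]
    using integral_of_real[of M "\<lambda>x. x\<^sup>2", where 'a = complex] sq by simp
  also have "norm \<dots> \<le> (LINT x|M. norm (?f x))"
    by (rule integral_norm_bound)
  also have "\<dots> \<le> (LINT x|M. \<eta> * x\<^sup>2 + u\<^sup>2 * (indicat_real {x. \<bar>x - 1\<bar> > d} x * x\<^sup>2))"
  proof (intro integral_mono integrable_norm f)
    show "integrable M (\<lambda>x. \<eta> * x\<^sup>2 + u\<^sup>2 * (indicat_real {x. \<bar>x - 1\<bar> > d} x * x\<^sup>2))"
      by (intro Bochner_Integration.integrable_add integrable_mult_right sq ind)
    fix x :: real
    show "norm (?f x) \<le> \<eta> * x\<^sup>2 + u\<^sup>2 * (indicat_real {x. \<bar>x - 1\<bar> > d} x * x\<^sup>2)"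
    proof (cases "\<bar>x - 1\<bar> > d")
      case True
      have "norm (?f x) \<le> norm (compensated_exp u x) + x\<^sup>2 * norm (compensated_exp u 1)"
        using norm_triangle_ineq4[of "compensated_exp u x" "x\<^sup>2 * compensated_exp u 1"] by (simp add: norm_mult norm_power)
      also have "\<dots> \<le> u\<^sup>2 * x\<^sup>2 / 2 + x\<^sup>2 * (u\<^sup>2 * 1\<^sup>2 / 2)"
        by (intro add_mono mult_left_mono norm_compensated_exp_le) simp
      finally have "norm (?f x) \<le> u\<^sup>2 * x\<^sup>2" by (simp add: mult.commute)
      moreover have "0 \<le> \<eta> * x\<^sup>2" using \<eta> by simp
      ultimately show ?thesis using True by simp
    next
      case False
      then show ?thesis using near[of x] by simp
    qed
  qed
  also have "\<dots> = \<eta> * (LINT x|M. x\<^sup>2) + u\<^sup>2 * (LINT x:{x. \<bar>x - 1\<bar> > d}|M. x\<^sup>2)"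
    using sq ind by (simp add: set_lebesgue_integral_def)
  finally show ?thesis .
qed

end

lemma (in real_distribution) interval_measure_cdf: "interval_measure (cdf M) = M"
proof (rule cdf_unique)
  show "real_distribution (interval_measure (cdf M))"
    by (intro real_distribution_interval_measure cdf_nondecreasing cdf_is_right_cont
        cdf_lim_at_bot cdf_lim_at_top_prob)
  show "cdf (interval_measure (cdf M)) = cdf M"
    by (intro cdf_interval_measure cdf_nondecreasing cdf_is_right_cont cdf_lim_at_bot)
qed (rule real_distribution_axioms)

section \<open>Variance of independent sums and boundedness of centrings\<close>

lemma (in prob_space) expectation_square_sum_indep:
  fixes Y :: "'b \<Rightarrow> 'a \<Rightarrow> real"
  assumes fin: "finite I" and ind: "indep_vars (\<lambda>_. borel) Y I"
    and sq: "\<And>i. i \<in> I \<Longrightarrow> integrable M (\<lambda>\<omega>. (Y i \<omega>)\<^sup>2)"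
    and mean: "\<And>i. i \<in> I \<Longrightarrow> expectation (Y i) = 0"
  shows "integrable M (\<lambda>\<omega>. (\<Sum>i\<in>I. Y i \<omega>)\<^sup>2)"
    and "expectation (\<lambda>\<omega>. (\<Sum>i\<in>I. Y i \<omega>)\<^sup>2) = (\<Sum>i\<in>I. expectation (\<lambda>\<omega>. (Y i \<omega>)\<^sup>2))"
proof -
  have rv: "random_variable borel (Y i)" if "i \<in> I" for i
    using ind that by (simp add: indep_vars_def2)
  have int: "integrable M (Y i)" if "i \<in> I" for i
    using square_integrable_imp_integrable[OF rv sq] that by blast
  have pair: "integrable M (\<lambda>\<omega>. Y i \<omega> * Y j \<omega>) \<and>
      expectation (\<lambda>\<omega>. Y i \<omega> * Y j \<omega>) = (if i = j then expectation (\<lambda>\<omega>. (Y i \<omega>)\<^sup>2) else 0)"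
    if ij: "i \<in> I" "j \<in> I" for i j
  proof (cases "i = j")
    case True
    then show ?thesis using sq[OF ij(1)] by (simp add: power2_eq_square)
  next
    case False
    then have "indep_var borel (Y i) borel (Y j)"
      using indep_vars_sum[of "{j}" i Y] indep_vars_subset[OF ind, of "{i, j}"] ij by simp
    then show ?thesis
      using indep_var_integrable[of "Y i" "Y j"] indep_var_lebesgue_integral[of "Y i" "Y j"]
        False ij int mean by simp
  qed
  have expand: "(\<lambda>\<omega>. (\<Sum>i\<in>I. Y i \<omega>)\<^sup>2) = (\<lambda>\<omega>. \<Sum>i\<in>I. \<Sum>j\<in>I. Y i \<omega> * Y j \<omega>)"
    by (simp add: power2_eq_square sum_product)
  show "integrable M (\<lambda>\<omega>. (\<Sum>i\<in>I. Y i \<omega>)\<^sup>2)"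
    unfolding expand using pair by (intro Bochner_Integration.integrable_sum) auto
  have "expectation (\<lambda>\<omega>. (\<Sum>i\<in>I. Y i \<omega>)\<^sup>2) = (\<Sum>i\<in>I. \<Sum>j\<in>I. expectation (\<lambda>\<omega>. Y i \<omega> * Y j \<omega>))"
    unfolding expand using pair
    by (subst Bochner_Integration.integral_sum)
       (auto intro!: Bochner_Integration.integrable_sum sum.cong Bochner_Integration.integral_sum)
  also have "\<dots> = (\<Sum>i\<in>I. \<Sum>j\<in>I. if i = j then expectation (\<lambda>\<omega>. (Y i \<omega>)\<^sup>2) else 0)"
    using pair by (intro sum.cong refl) auto
  also have "\<dots> = (\<Sum>i\<in>I. expectation (\<lambda>\<omega>. (Y i \<omega>)\<^sup>2))"
    using fin by simp
  finally show "expectation (\<lambda>\<omega>. (\<Sum>i\<in>I. Y i \<omega>)\<^sup>2) = (\<Sum>i\<in>I. expectation (\<lambda>\<omega>. (Y i \<omega>)\<^sup>2))" .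
qed

text \<open>
  The function \<open>d\<^sub>R(x) = min 1 (|x| / R)\<close> is subadditive, so \<open>d\<^sub>R(A)\<close> is at most the mean of
  \<open>d\<^sub>R(x) + d\<^sub>R(x - A)\<close>. For large \<open>R\<close> the first mean is small in the limit law, hence eventually along the
  sequence, and the second is small by the variance bound; but \<open>d\<^sub>R(A) < 1\<close> means \<open>|A| < R\<close>.
\<close>

lemma weak_conv_imp_centering_bounded:
  fixes A :: "nat \<Rightarrow> real"
  assumes \<mu>: "\<And>n. real_distribution (\<mu> n)" and \<mu>': "real_distribution \<mu>'"
    and conv: "weak_conv_m \<mu> \<mu>'"
    and int: "\<And>n. integrable (\<mu> n) (\<lambda>x. (x - A n)\<^sup>2)"
    and var: "\<And>n. (LINT x|\<mu> n. (x - A n)\<^sup>2) \<le> V"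
  shows "\<exists>B. \<forall>\<^sub>F n in sequentially. \<bar>A n\<bar> \<le> B"
proof -
  let ?d = "\<lambda>R x :: real. min 1 (\<bar>x\<bar> / R)"
  interpret L: real_distribution \<mu>' by fact
  have d_int: "integrable N (\<lambda>x. ?d R (x - c))" if "real_distribution N" "0 < R" for N R c
  proof -
    interpret N: real_distribution N by fact
    show ?thesis
      using that by (intro N.integrable_const_bound[where B = 1]) auto
  qed
  have "(\<lambda>m. LINT x|\<mu>'. ?d (real (Suc m)) x) \<longlonglongrightarrow> (LINT x|\<mu>'. min 1 0)"
  proof (rule integral_dominated_convergence[where w = "\<lambda>_. 1"])
    have "(\<lambda>m. ?d (real (Suc m)) x) \<longlonglongrightarrow> min 1 0" for x
      by (intro tendsto_min tendsto_const LIMSEQ_Suc[OF lim_const_over_n])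
    then show "AE x in \<mu>'. (\<lambda>m. ?d (real (Suc m)) x) \<longlonglongrightarrow> min 1 0"
      by (intro AE_I2)
  qed auto
  then have "(\<lambda>m. LINT x|\<mu>'. ?d (real (Suc m)) x) \<longlonglongrightarrow> 0" by simp
  then have "\<forall>\<^sub>F m in sequentially. (LINT x|\<mu>'. ?d (real (Suc m)) x) < 1/4"
    by (rule order_tendstoD) simp
  moreover have "\<forall>\<^sub>F m in sequentially. 4 * (V + 1) \<le> real m"
    by (rule eventually_ge_at_top[THEN eventually_compose_filterlim, OF filterlim_real_sequentially])
  ultimately have "\<forall>\<^sub>F m in sequentially. (LINT x|\<mu>'. ?d (real (Suc m)) x) < 1/4 \<and> 4 * (V + 1) \<le> real m"
    by (rule eventually_conj)
  then obtain m where m: "(LINT x|\<mu>'. ?d (real (Suc m)) x) < 1/4" "4 * (V + 1) \<le> real m"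
    by (auto dest: eventually_happens)
  define R where "R = real (Suc m)"
  have R: "(LINT x|\<mu>'. ?d R x) < 1/4" "4 * (V + 1) \<le> R" "0 < R"
    using m by (auto simp: R_def)
  have "(\<lambda>n. LINT x|\<mu> n. ?d R x) \<longlonglongrightarrow> (LINT x|\<mu>'. ?d R x)"
    using R(3) by (intro weak_conv_imp_integral_bdd_continuous_conv[OF \<mu> \<mu>' conv, where B = 1] continuous_intros) auto
  then have "\<forall>\<^sub>F n in sequentially. (LINT x|\<mu> n. ?d R x) < 1/4"
    by (rule order_tendstoD) (rule R(1))
  then have "\<forall>\<^sub>F n in sequentially. \<bar>A n\<bar> \<le> R"
  proof eventually_elim
    case (elim n)
    interpret N: real_distribution "\<mu> n" by (rule \<mu>)
    have subadd: "?d R (A n) \<le> ?d R x + ((x - A n)\<^sup>2 + 1) / R" for x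
    proof -
      have "\<bar>x - A n\<bar> \<le> (x - A n)\<^sup>2 + 1"
        using zero_le_power2[of "\<bar>x - A n\<bar> - 1 / 2"] by (simp add: power2_eq_square algebra_simps)
      then have "\<bar>x - A n\<bar> / R \<le> ((x - A n)\<^sup>2 + 1) / R"
        using R(3) by (intro divide_right_mono) auto
      moreover have "\<bar>A n\<bar> / R \<le> \<bar>x\<bar> / R + \<bar>x - A n\<bar> / R"
        using R(3) unfolding add_divide_distrib[symmetric] by (intro divide_right_mono) auto
      moreover have "0 \<le> \<bar>x - A n\<bar> / R" using R(3) by simp
      ultimately show ?thesis by linarith
    qed
    have "?d R (A n) = (LINT x|\<mu> n. ?d R (A n))" by (simp add: N.prob_UNIV)
    also have "\<dots> \<le> (LINT x|\<mu> n. ?d R x + ((x - A n)\<^sup>2 + 1) / R)"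
      using int[of n] d_int[OF \<mu> R(3), of n 0] R(3) by (intro integral_mono subadd) auto
    also have "\<dots> = (LINT x|\<mu> n. ?d R x) + ((LINT x|\<mu> n. (x - A n)\<^sup>2) + 1) / R"
      using int[of n] d_int[OF \<mu> R(3), of n 0] R(3) by (simp add: N.prob_UNIV add_divide_distrib)
    also have "\<dots> < 1/4 + (V + 1) / R"
      using elim var[of n] R(3) by (intro add_less_le_mono divide_right_mono) auto
    also have "(V + 1) / R \<le> 1/4" using R by (simp add: field_simps)
    finally have "?d R (A n) < 1" by simp
    then have "\<bar>A n\<bar> / R < 1" by (simp add: min_less_iff_disj)
    then show ?case using R(3) by simp
  qed
  then show ?thesis by blast
qed

section \<open>Arrays of centred laws with uniformly small variances\<close>

text \<open>A row is represented by the laws of its members. The sequence \<open>m\<close> is any null sequence dominating the variances of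
  the rows.\<close>

locale null_array =
  fixes \<nu> :: "nat \<Rightarrow> 'i \<Rightarrow> real measure" and I :: "nat \<Rightarrow> 'i set" and m :: "nat \<Rightarrow> real" and lam :: real
  assumes finite_row: "\<And>n. finite (I n)"
    and distribution: "\<And>n k. k \<in> I n \<Longrightarrow> real_distribution (\<nu> n k)"
    and square_integrable: "\<And>n k. k \<in> I n \<Longrightarrow> integrable (\<nu> n k) (\<lambda>x. x\<^sup>2)"
    and centered: "\<And>n k. k \<in> I n \<Longrightarrow> (LINT x|\<nu> n k. x) = 0"
    and variance_le: "\<And>n k. k \<in> I n \<Longrightarrow> (LINT x|\<nu> n k. x\<^sup>2) \<le> m n"
    and max_tendsto: "m \<longlonglongrightarrow> 0"
    and total_tendsto: "(\<lambda>n. \<Sum>k\<in>I n. LINT x|\<nu> n k. x\<^sup>2) \<longlonglongrightarrow> lam"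
begin

definition total_variance :: "nat \<Rightarrow> real" where
  "total_variance n = (\<Sum>k\<in>I n. LINT x|\<nu> n k. x\<^sup>2)"

text \<open>The logarithm of the characteristic function of the accompanying compound Poisson law.\<close>

definition log_char :: "nat \<Rightarrow> real \<Rightarrow> complex" where
  "log_char n u = (\<Sum>k\<in>I n. char (\<nu> n k) u - 1)"

definition off_one :: "nat \<Rightarrow> real \<Rightarrow> real" where
  "off_one n \<epsilon> = (\<Sum>k\<in>I n. LINT x:{x. \<bar>x - 1\<bar> > \<epsilon>}|\<nu> n k. x\<^sup>2)"

lemma total_variance_tendsto: "total_variance \<longlonglongrightarrow> lam"
  using total_tendsto by (simp add: total_variance_def[abs_def])

lemma norm_char_minus_one:
  assumes "k \<in> I n"
  shows "norm (char (\<nu> n k) u - 1) \<le> u\<^sup>2 / 2 * (LINT x|\<nu> n k. x\<^sup>2)"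
  using real_distribution.norm_char_minus_one_le distribution square_integrable centered assms by blast

lemma norm_log_char_le: "norm (log_char n u) \<le> u\<^sup>2 / 2 * total_variance n"
  unfolding log_char_def total_variance_def sum_distrib_left
  by (intro sum_norm_le norm_char_minus_one)

lemma off_one_nonneg: "0 \<le> off_one n \<epsilon>"
  unfolding off_one_def set_lebesgue_integral_def
  by (intro sum_nonneg Bochner_Integration.integral_nonneg) auto

text \<open>
  With \<open>z\<^sub>k = char \<nu>\<^sub>k u - 1\<close>, all factors lie in the unit disc, so the products differ by at most
  \<open>\<Sum>\<^sub>k |1 + z\<^sub>k - exp z\<^sub>k| \<le> 3 \<Sum>\<^sub>k |z\<^sub>k|\<^sup>2\<close>. Since \<open>|z\<^sub>k|\<close> is at most \<open>u\<^sup>2 / 2\<close> times a variance,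
  this is bounded, up to a factor depending on \<open>u\<close>, by the largest variance times the sum of all of them.
\<close>

lemma prod_char_minus_exp_log_char:
  "(\<lambda>n. (\<Prod>k\<in>I n. char (\<nu> n k) u) - exp (log_char n u)) \<longlonglongrightarrow> 0"
proof (rule Lim_null_comparison)
  have "(\<lambda>n. u\<^sup>2 / 2 * m n) \<longlonglongrightarrow> u\<^sup>2 / 2 * 0"
    by (intro tendsto_intros max_tendsto)
  then have "\<forall>\<^sub>F n in sequentially. u\<^sup>2 / 2 * m n < 1"
    by (rule order_tendstoD) simp
  then show "\<forall>\<^sub>F n in sequentially. norm ((\<Prod>k\<in>I n. char (\<nu> n k) u) - exp (log_char n u))
    \<le> 3 * (u\<^sup>2 / 2 * m n) * (u\<^sup>2 / 2 * total_variance n)"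
  proof eventually_elim
    case (elim n)
    have le_1: "norm (char (\<nu> n k) u) \<le> 1" if "k \<in> I n" for k
      by (rule real_distribution.cmod_char_le_1[OF distribution[OF that]])
    have exp_le_1: "norm (exp (char (\<nu> n k) u - 1)) \<le> 1" if "k \<in> I n" for k
      using le_1[OF that] complex_Re_le_cmod[of "char (\<nu> n k) u"] by simp
    have step: "norm (char (\<nu> n k) u - exp (char (\<nu> n k) u - 1)) \<le> 3 * (u\<^sup>2 / 2 * m n) * (u\<^sup>2 / 2 * (LINT x|\<nu> n k. x\<^sup>2))"
      if k: "k \<in> I n" for k
    proof -
      let ?z = "char (\<nu> n k) u - 1"
      have z: "norm ?z \<le> u\<^sup>2 / 2 * (LINT x|\<nu> n k. x\<^sup>2)" by (rule norm_char_minus_one[OF k])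
      also have "\<dots> \<le> u\<^sup>2 / 2 * m n" by (intro mult_left_mono variance_le k) simp
      finally have zm: "norm ?z \<le> u\<^sup>2 / 2 * m n" .
      have "norm (char (\<nu> n k) u - exp ?z) = norm (exp ?z - 1 - ?z)"
        by (simp add: norm_minus_commute)
      also have "\<dots> \<le> 3 * (norm ?z)\<^sup>2"
        using zm elim by (intro norm_exp_minus_linear_le) simp
      also have "\<dots> \<le> 3 * ((u\<^sup>2 / 2 * m n) * (u\<^sup>2 / 2 * (LINT x|\<nu> n k. x\<^sup>2)))"
        unfolding power2_eq_square[of "norm ?z"]
        using zm z order_trans[OF norm_ge_zero zm] by (intro mult_left_mono mult_mono) auto
      finally show ?thesis by (simp only: mult.assoc)
    qed
    have "norm ((\<Prod>k\<in>I n. char (\<nu> n k) u) - (\<Prod>k\<in>I n. exp (char (\<nu> n k) u - 1)))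
      \<le> (\<Sum>k\<in>I n. norm (char (\<nu> n k) u - exp (char (\<nu> n k) u - 1)))"
      by (intro norm_prod_diff le_1 exp_le_1)
    also have "\<dots> \<le> (\<Sum>k\<in>I n. 3 * (u\<^sup>2 / 2 * m n) * (u\<^sup>2 / 2 * (LINT x|\<nu> n k. x\<^sup>2)))"
      by (intro sum_mono step)
    also have "\<dots> = 3 * (u\<^sup>2 / 2 * m n) * (u\<^sup>2 / 2 * total_variance n)"
      by (simp only: sum_distrib_left[symmetric] total_variance_def)
    finally show ?case
      by (simp only: log_char_def exp_sum[OF finite_row])
  qed
  have "(\<lambda>n. 3 * (u\<^sup>2 / 2 * m n) * (u\<^sup>2 / 2 * total_variance n)) \<longlonglongrightarrow> 3 * (u\<^sup>2 / 2 * 0) * (u\<^sup>2 / 2 * lam)"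
    by (intro tendsto_intros max_tendsto total_variance_tendsto)
  then show "(\<lambda>n. 3 * (u\<^sup>2 / 2 * m n) * (u\<^sup>2 / 2 * total_variance n)) \<longlonglongrightarrow> 0" by simp
qed

section \<open>The exponents and the concentration of the second moments at 1\<close>

lemma log_char_tendsto_poisson:
  assumes off: "\<And>\<epsilon>. 0 < \<epsilon> \<Longrightarrow> (\<lambda>n. off_one n \<epsilon>) \<longlonglongrightarrow> 0"
  shows "(\<lambda>n. log_char n u) \<longlonglongrightarrow> lam * compensated_exp u 1"
proof -
  have "(\<lambda>n. log_char n u - total_variance n * compensated_exp u 1) \<longlonglongrightarrow> 0"
  proof (rule tendstoI)
    fix e :: real assume e: "0 < e"
    have lam: "0 \<le> lam"
      by (rule LIMSEQ_le_const[OF total_tendsto]) (auto intro!: sum_nonneg)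
    define \<eta> where "\<eta> = e / (lam + 1)"
    have \<eta>: "0 < \<eta>" using e lam by (simp add: \<eta>_def)
    obtain d where d: "0 < d"
        "\<And>x. \<bar>x - 1\<bar> \<le> d \<Longrightarrow> norm (compensated_exp u x - x\<^sup>2 * compensated_exp u 1) \<le> \<eta> * x\<^sup>2"
      using compensated_exp_near_one[OF \<eta>] by blast
    have bound: "norm (log_char n u - total_variance n * compensated_exp u 1) \<le> \<eta> * total_variance n + u\<^sup>2 * off_one n d" for n
    proof -
      have "log_char n u - total_variance n * compensated_exp u 1 =
          (\<Sum>k\<in>I n. char (\<nu> n k) u - 1 - (LINT x|\<nu> n k. x\<^sup>2) * compensated_exp u 1)"
        by (simp add: log_char_def total_variance_def sum_subtractf sum_distrib_right)
      also have "norm \<dots> \<le> (\<Sum>k\<in>I n. \<eta> * (LINT x|\<nu> n k. x\<^sup>2) + u\<^sup>2 * (LINT x:{x. \<bar>x - 1\<bar> > d}|\<nu> n k. x\<^sup>2))"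
        using d(2) \<eta> by (intro sum_norm_le real_distribution.char_poisson_approx
            distribution square_integrable centered) auto
      also have "\<dots> = \<eta> * total_variance n + u\<^sup>2 * off_one n d"
        by (simp only: sum.distrib sum_distrib_left total_variance_def off_one_def)
      finally show ?thesis .
    qed
    have "(\<lambda>n. \<eta> * total_variance n + u\<^sup>2 * off_one n d) \<longlonglongrightarrow> \<eta> * lam + u\<^sup>2 * 0"
      by (intro tendsto_intros total_variance_tendsto off d(1))
    moreover have "\<eta> * lam + u\<^sup>2 * 0 < e"
      using e lam by (simp add: \<eta>_def field_simps)
    ultimately have "\<forall>\<^sub>F n in sequentially. \<eta> * total_variance n + u\<^sup>2 * off_one n d < e"
      by (rule order_tendstoD)
    then show "\<forall>\<^sub>F n in sequentially. dist (log_char n u - total_variance n * compensated_exp u 1) 0 < e"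
      by eventually_elim (use bound in \<open>auto intro: le_less_trans\<close>)
  qed
  moreover have "(\<lambda>n. total_variance n * compensated_exp u 1) \<longlonglongrightarrow> lam * compensated_exp u 1"
    by (intro tendsto_intros total_variance_tendsto)
  ultimately show ?thesis
    using tendsto_add by fastforce
qed

text \<open>
  Convergence of the exponents is assumed on a neighbourhood of \<open>0\<close> only; this suffices because the test functions
  with parameter \<open>h\<close> use no frequency beyond \<open>3h/2\<close>.
\<close>

lemma off_one_tendsto_zero:
  assumes \<delta>: "0 < \<delta>" and lim: "\<And>u. \<bar>u\<bar> \<le> \<delta> \<Longrightarrow> (\<lambda>n. log_char n u) \<longlonglongrightarrow> lam * compensated_exp u 1"
    and \<epsilon>: "0 < \<epsilon>"
  shows "(\<lambda>n. off_one n \<epsilon>) \<longlonglongrightarrow> 0"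
proof (rule tendstoI)
  fix e :: real assume e: "0 < e"
  have lam: "0 \<le> lam"
    by (rule LIMSEQ_le_const[OF total_tendsto]) (auto intro!: sum_nonneg)
  \<comment> \<open>The limit of the upper bound is at most \<open>\<lambda> h\<^sup>2 / 6\<close>, so this \<open>h\<close> makes it smaller than \<open>e\<close>.\<close>
  define h where "h = min (min 1 (\<delta> / 2)) (e / (lam + 1))"
  have h: "0 < h" "h \<le> 1" "h \<le> \<delta> / 2" "h \<le> e / (lam + 1)"
  proof -
    have "0 < e / (lam + 1)" using e lam by (intro divide_pos_pos) auto
    then show "0 < h" using \<delta> by (simp add: h_def)
    show "h \<le> 1" "h \<le> \<delta> / 2" "h \<le> e / (lam + 1)" unfolding h_def by linarith+
  qed
  \<comment> \<open>The linear functional that integrates \<open>(1 - cos hx) (1 - cos (h(x - 1)/2))\<close>, in terms of \<open>char - 1\<close>.\<close>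
  define L where "L = (\<lambda>z. Re (- (z h + z (- h)) / 2
        + exp (- \<i> * (h / 2)) * (z (h / 2 + h) + z (h / 2 - h) - 2 * z (h / 2)) / 2))"
  have bound: "off_one n \<epsilon> \<le> 2 * (total_variance n + 2 / h\<^sup>2 * Re (log_char n h))
      + 256 / (h ^ 4 * \<epsilon>\<^sup>2) * L (log_char n)" for n
  proof -
    have "off_one n \<epsilon> \<le> (\<Sum>k\<in>I n. 2 * ((LINT x|\<nu> n k. x\<^sup>2) - 2 / h\<^sup>2 * (- Re (char (\<nu> n k) h - 1)))
        + 256 / (h ^ 4 * \<epsilon>\<^sup>2) * L (\<lambda>v. char (\<nu> n k) v - 1))"
      unfolding off_one_def
    proof (rule sum_mono)
      fix k assume k: "k \<in> I n"
      interpret real_distribution "\<nu> n k" by (rule distribution[OF k])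
      show "(LINT x:{x. \<bar>x - 1\<bar> > \<epsilon>}|\<nu> n k. x\<^sup>2) \<le>
          2 * ((LINT x|\<nu> n k. x\<^sup>2) - 2 / h\<^sup>2 * (- Re (char (\<nu> n k) h - 1)))
          + 256 / (h ^ 4 * \<epsilon>\<^sup>2) * L (\<lambda>v. char (\<nu> n k) v - 1)"
        using second_moment_off_one_le[OF square_integrable[OF k] h(1,2) \<epsilon>]
        unfolding integral_one_minus_cos integral_localized_test L_def .
    qed
    also have "\<dots> = 2 * (total_variance n + 2 / h\<^sup>2 * (\<Sum>k\<in>I n. Re (char (\<nu> n k) h - 1)))
        + 256 / (h ^ 4 * \<epsilon>\<^sup>2) * (\<Sum>k\<in>I n. L (\<lambda>v. char (\<nu> n k) v - 1))"
      by (simp only: total_variance_def sum.distrib sum_distrib_left[symmetric] mult_minus_right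
          diff_minus_eq_add)
    also have "(\<Sum>k\<in>I n. Re (char (\<nu> n k) h - 1)) = Re (log_char n h)"
      by (simp only: log_char_def Re_sum)
    also have "(\<Sum>k\<in>I n. L (\<lambda>v. char (\<nu> n k) v - 1)) = L (log_char n)"
      unfolding L_def log_char_def Re_sum[symmetric]
      by (intro arg_cong[where f = Re])
         (simp only: sum.distrib sum_subtractf sum_negf sum_distrib_left[symmetric] sum_divide_distrib[symmetric])
    finally show ?thesis .
  qed
  have L_lim: "(\<lambda>n. L (log_char n)) \<longlonglongrightarrow> L (\<lambda>v. lam * compensated_exp v 1)"
    unfolding L_def using h by (intro tendsto_intros lim) auto
  \<comment> \<open>The localized test function vanishes at \<open>1\<close>. In the second differences the linear
    terms of the compensated exponentials cancel, so the functional sees it as if they were plain exponentials.\<close>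
  have twisted: "exp (- \<i> * (h / 2)) * (compensated_exp (h / 2 + h) 1 + compensated_exp (h / 2 - h) 1 - 2 * compensated_exp (h / 2) 1)
      = compensated_exp h 1 + compensated_exp (- h) 1"
  proof -
    have "compensated_exp (h / 2 + h) 1 + compensated_exp (h / 2 - h) 1 - 2 * compensated_exp (h / 2) 1
        = exp (\<i> * (h / 2)) * (compensated_exp h 1 + compensated_exp (- h) 1)"
      by (simp add: compensated_exp_def algebra_simps exp_add[symmetric])
    then show ?thesis
      by (simp add: exp_minus)
  qed
  have "L (\<lambda>v. lam * compensated_exp v 1) = 0"
  proof -
    have "w * (lam * p + lam * q - 2 * (lam * r)) = lam * (w * (p + q - 2 * r))" for w p q r :: complex
      by (simp add: algebra_simps)
    then show ?thesis
      unfolding L_def by (simp only: twisted) (simp add: field_simps)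
  qed
  with L_lim have L_lim: "(\<lambda>n. L (log_char n)) \<longlonglongrightarrow> 0" by simp
  have "(\<lambda>n. 2 * (total_variance n + 2 / h\<^sup>2 * Re (log_char n h)) + 256 / (h ^ 4 * \<epsilon>\<^sup>2) * L (log_char n))
    \<longlonglongrightarrow> 2 * (lam + 2 / h\<^sup>2 * Re (lam * compensated_exp h 1)) + 256 / (h ^ 4 * \<epsilon>\<^sup>2) * 0"
    using h by (intro tendsto_add tendsto_mult tendsto_const tendsto_Re total_variance_tendsto L_lim lim) auto
  moreover have "2 * (lam + 2 / h\<^sup>2 * Re (lam * compensated_exp h 1)) + 256 / (h ^ 4 * \<epsilon>\<^sup>2) * 0 < e"
  proof -
    have "2 / h\<^sup>2 * (h\<^sup>2 / 2 - h ^ 4 / 24) \<le> 2 / h\<^sup>2 * (1 - cos h)"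
      by (intro mult_left_mono one_minus_cos_bounds) simp
    moreover have "2 / h\<^sup>2 * (h\<^sup>2 / 2 - h ^ 4 / 24) = 1 - h\<^sup>2 / 12"
      using h by (simp add: field_simps power2_eq_square power4_eq_xxxx)
    ultimately have "1 - 2 / h\<^sup>2 * (1 - cos h) \<le> h\<^sup>2 / 12" by linarith
    then have "2 * (lam * (1 - 2 / h\<^sup>2 * (1 - cos h))) \<le> 2 * (lam * (h\<^sup>2 / 12))"
      using lam by (intro mult_left_mono) auto
    moreover have "2 * (lam + 2 / h\<^sup>2 * Re (lam * compensated_exp h 1)) = 2 * (lam * (1 - 2 / h\<^sup>2 * (1 - cos h)))"
    proof -
      have "Re (lam * compensated_exp h 1) = lam * (cos h - 1)"
        by (simp add: compensated_exp_def Re_exp)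
      moreover have "2 * (lam + c * (lam * (v - 1))) = 2 * (lam * (1 - c * (1 - v)))" for c v
        by (simp add: algebra_simps)
      ultimately show ?thesis by (simp only:)
    qed
    moreover have "lam * h\<^sup>2 \<le> e"
    proof -
      have "h\<^sup>2 \<le> h" using h by (simp add: power2_eq_square mult_left_le)
      then have "lam * h\<^sup>2 \<le> lam * (e / (lam + 1))" using h lam by (intro mult_left_mono) auto
      also have "\<dots> \<le> e" using e lam by (simp add: field_simps)
      finally show ?thesis .
    qed
    ultimately show ?thesis using e by linarith
  qed
  ultimately have "\<forall>\<^sub>F n in sequentially.
      2 * (total_variance n + 2 / h\<^sup>2 * Re (log_char n h)) + 256 / (h ^ 4 * \<epsilon>\<^sup>2) * L (log_char n) < e"
    by (rule order_tendstoD)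
  then show "\<forall>\<^sub>F n in sequentially. dist (off_one n \<epsilon>) 0 < e"
    by eventually_elim (use bound off_one_nonneg in \<open>auto intro: le_less_trans\<close>)
qed

text \<open>
  The bound on \<open>A\<close> keeps the difference \<open>D\<close> of the exponents in the disc of radius \<open>1/6\<close> for
  \<open>|u| \<le> \<delta>\<close>, so \<open>D \<longlonglongrightarrow> 0\<close>. The part of \<open>D\<close> that is not linear in \<open>u\<close> is \<open>O(u\<^sup>2)\<close> uniformly, hence
  \<open>|A - a|\<close> is eventually \<open>O(u)\<close> for each fixed \<open>u\<close>, which gives \<open>A \<longlonglongrightarrow> a\<close>.
\<close>

lemma exp_limit_imp_exponent_limit:
  fixes A :: "nat \<Rightarrow> real" and a B :: real
  assumes bounded: "\<forall>\<^sub>F n in sequentially. \<bar>A n\<bar> \<le> B"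
    and lim: "\<And>u. (\<lambda>n. exp (\<i> * (u * A n) + log_char n u)) \<longlonglongrightarrow> exp (\<i> * (u * a) + lam * compensated_exp u 1)"
  obtains \<delta> where "0 < \<delta>" "A \<longlonglongrightarrow> a"
    "\<And>u. \<bar>u\<bar> \<le> \<delta> \<Longrightarrow> (\<lambda>n. log_char n u) \<longlonglongrightarrow> lam * compensated_exp u 1"
proof -
  define D where "D u n = \<i> * (u * (A n - a)) + (log_char n u - lam * compensated_exp u 1)" for u n
  have lam: "0 \<le> lam"
    by (rule LIMSEQ_le_const[OF total_tendsto]) (auto intro!: sum_nonneg)
  have variance_bounded: "\<forall>\<^sub>F n in sequentially. total_variance n < lam + 1"
    by (rule order_tendstoD[OF total_variance_tendsto]) simp
  have rest: "norm (log_char n u - lam * compensated_exp u 1) \<le> u\<^sup>2 * (lam + 1)"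
    if "total_variance n < lam + 1" for n u
  proof -
    have "norm (log_char n u - lam * compensated_exp u 1) \<le> norm (log_char n u) + norm (lam * compensated_exp u 1)"
      by (rule norm_triangle_ineq4)
    also have "\<dots> \<le> u\<^sup>2 / 2 * total_variance n + lam * (u\<^sup>2 * 1\<^sup>2 / 2)"
      unfolding norm_mult norm_of_real abs_of_nonneg[OF lam]
      by (intro add_mono norm_log_char_le mult_left_mono norm_compensated_exp_le lam)
    also have "\<dots> \<le> u\<^sup>2 / 2 * (lam + 1) + lam * (u\<^sup>2 * 1\<^sup>2 / 2)"
      using that by (intro add_right_mono mult_left_mono) auto
    also have "\<dots> \<le> u\<^sup>2 * (lam + 1)" by (simp add: field_simps)
    finally show ?thesis .
  qed
  define C where "C = \<bar>B\<bar> + \<bar>a\<bar> + lam + 1"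
  have C: "1 \<le> C" using lam by (simp add: C_def)
  define \<delta> where "\<delta> = 1 / (6 * C)"
  have \<delta>: "0 < \<delta>" "\<delta> \<le> 1" "\<delta> * C = 1 / 6" using C by (auto simp: \<delta>_def field_simps)
  have D_lim: "D u \<longlonglongrightarrow> 0" if u: "\<bar>u\<bar> \<le> \<delta>" for u
  proof (rule tendsto_zero_if_exp_tendsto_one)
    show "\<forall>\<^sub>F n in sequentially. norm (D u n) \<le> 1 / 6"
      using bounded variance_bounded
    proof eventually_elim
      case (elim n)
      have "norm (D u n) \<le> norm (\<i> * complex_of_real (u * (A n - a))) + norm (log_char n u - lam * compensated_exp u 1)"
        unfolding D_def by (rule norm_triangle_ineq)
      also have "norm (\<i> * complex_of_real (u * (A n - a))) = \<bar>u\<bar> * \<bar>A n - a\<bar>"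
        by (simp only: norm_mult norm_ii norm_of_real abs_mult mult_1_left)
      also have "\<bar>u\<bar> * \<bar>A n - a\<bar> \<le> \<bar>u\<bar> * (\<bar>B\<bar> + \<bar>a\<bar>)"
        using elim by (intro mult_left_mono) auto
      also have "norm (log_char n u - lam * compensated_exp u 1) \<le> u\<^sup>2 * (lam + 1)"
        using elim by (intro rest)
      also have "u\<^sup>2 * (lam + 1) \<le> \<bar>u\<bar> * (lam + 1)"
      proof (intro mult_right_mono)
        have "\<bar>u\<bar> * \<bar>u\<bar> \<le> \<bar>u\<bar> * 1" using u \<delta>(2) by (intro mult_left_mono) auto
        then show "u\<^sup>2 \<le> \<bar>u\<bar>" by (simp add: power2_eq_square)
      qed (use lam in simp)
      also have "\<bar>u\<bar> * (\<bar>B\<bar> + \<bar>a\<bar>) + \<bar>u\<bar> * (lam + 1) = \<bar>u\<bar> * C"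
        by (simp add: C_def algebra_simps)
      also have "\<dots> \<le> \<delta> * C" using u C by (intro mult_right_mono) auto
      finally show ?case using \<delta>(3) by simp
    qed
    have "(\<lambda>n. exp (\<i> * (u * A n) + log_char n u) / exp (\<i> * (u * a) + lam * compensated_exp u 1))
        \<longlonglongrightarrow> exp (\<i> * (u * a) + lam * compensated_exp u 1) / exp (\<i> * (u * a) + lam * compensated_exp u 1)"
      by (intro tendsto_divide lim tendsto_const) simp
    then show "(\<lambda>n. exp (D u n)) \<longlonglongrightarrow> 1"
      by (simp add: D_def exp_diff[symmetric] algebra_simps)
  qed
  have A_lim: "A \<longlonglongrightarrow> a"
  proof (rule tendstoI)
    fix e :: real assume e: "0 < e"
    define u where "u = min \<delta> (e / (2 * (lam + 1)))"
    have u: "0 < u" "u \<le> \<delta>" "u * (lam + 1) \<le> e / 2"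
    proof -
      have "0 < e / (2 * (lam + 1))" using e lam by (intro divide_pos_pos) auto
      then show "0 < u" "u \<le> \<delta>" using \<delta> by (auto simp: u_def)
      have "u \<le> e / (2 * (lam + 1))" by (simp add: u_def)
      then have "u * (2 * (lam + 1)) \<le> e" using lam by (subst (asm) pos_le_divide_eq) auto
      then show "u * (lam + 1) \<le> e / 2" by (simp add: algebra_simps)
    qed
    have "\<forall>\<^sub>F n in sequentially. norm (D u n) < u * (e / 2)"
      using order_tendstoD(2)[OF tendsto_norm_zero[OF D_lim[of u]], of "u * (e / 2)"] u e by simp
    then show "\<forall>\<^sub>F n in sequentially. dist (A n) a < e"
      using variance_bounded
    proof eventually_elim
      case (elim n)
      have "u * \<bar>A n - a\<bar> = norm (\<i> * complex_of_real (u * (A n - a)))"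
        using u by (simp only: norm_mult norm_ii norm_of_real abs_mult mult_1_left abs_of_pos)
      also have "\<dots> = norm (D u n - (log_char n u - lam * compensated_exp u 1))"
        by (simp add: D_def)
      also have "\<dots> \<le> norm (D u n) + norm (log_char n u - lam * compensated_exp u 1)"
        by (rule norm_triangle_ineq4)
      also have "\<dots> < u * (e / 2) + u\<^sup>2 * (lam + 1)"
        using elim by (intro add_less_le_mono rest)
      also have "u\<^sup>2 * (lam + 1) \<le> u * (e / 2)"
        using mult_left_mono[OF u(3), of u] u(1) by (simp add: power2_eq_square mult.assoc)
      finally have "u * \<bar>A n - a\<bar> < u * e" by (simp add: mult.commute)
      then show ?case using u(1) by (simp add: dist_real_def)
    qed
  qed
  show thesis
  proof (rule that[OF \<delta>(1) A_lim])
    fix u :: real assume "\<bar>u\<bar> \<le> \<delta>"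
    then have "(\<lambda>n. D u n - \<i> * complex_of_real (u * (A n - a)) + lam * compensated_exp u 1)
        \<longlonglongrightarrow> 0 - \<i> * complex_of_real (u * (a - a)) + lam * compensated_exp u 1"
      by (intro tendsto_intros D_lim A_lim)
    then show "(\<lambda>n. log_char n u) \<longlonglongrightarrow> lam * compensated_exp u 1"
      by (simp add: D_def)
  qed
qed

section \<open>The convergence criterion\<close>

text \<open>Here \<open>\<mu> n\<close> stands for the law of a row sum with mean \<open>A n\<close>. Independence of the row enters
  through its two consequences: characteristic functions multiply and variances add.\<close>

theorem weak_conv_translated_poisson_iff:
  fixes \<mu> :: "nat \<Rightarrow> real measure" and A :: "nat \<Rightarrow> real"
  assumes lam: "0 < lam"
    and \<mu>: "\<And>n. real_distribution (\<mu> n)"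
    and char_\<mu>: "\<And>n u. char (\<mu> n) u = exp (\<i> * (u * A n)) * (\<Prod>k\<in>I n. char (\<nu> n k) u)"
    and int: "\<And>n. integrable (\<mu> n) (\<lambda>x. (x - A n)\<^sup>2)"
    and var: "\<And>n. (LINT x|\<mu> n. (x - A n)\<^sup>2) = (\<Sum>k\<in>I n. LINT x|\<nu> n k. x\<^sup>2)"
  shows "weak_conv_m \<mu> (translated_poisson b lam) \<longleftrightarrow>
    A \<longlonglongrightarrow> b + lam \<and> (\<forall>\<epsilon>>0. (\<lambda>n. off_one n \<epsilon>) \<longlonglongrightarrow> 0)"
proof -
  let ?\<psi> = "\<lambda>u. \<i> * (u * (b + lam)) + lam * compensated_exp u 1"
  have P: "real_distribution (translated_poisson b lam)"
    unfolding translated_poisson_def by (rule prob_space.real_distribution_distr) (simp_all add: prob_space_measure_pmf)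
  have char_P: "char (translated_poisson b lam) u = exp (?\<psi> u)" for u
    unfolding char_translated_poisson[OF lam] by (simp add: compensated_exp_def algebra_simps)
  have approx: "(\<lambda>n. char (\<mu> n) u - exp (\<i> * (u * A n) + log_char n u)) \<longlonglongrightarrow> 0" for u
  proof (rule Lim_null_comparison)
    have "norm (char (\<mu> n) u - exp (\<i> * (u * A n) + log_char n u))
        = norm ((\<Prod>k\<in>I n. char (\<nu> n k) u) - exp (log_char n u))" for n
    proof -
      have "char (\<mu> n) u - exp (\<i> * (u * A n) + log_char n u)
          = iexp (u * A n) * ((\<Prod>k\<in>I n. char (\<nu> n k) u) - exp (log_char n u))"
        by (simp add: char_\<mu> exp_add algebra_simps)
      then show ?thesis by (simp only: norm_mult norm_exp_i_times mult_1_left)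
    qed
    then show "\<forall>\<^sub>F n in sequentially. norm (char (\<mu> n) u - exp (\<i> * (u * A n) + log_char n u))
        \<le> norm ((\<Prod>k\<in>I n. char (\<nu> n k) u) - exp (log_char n u))"
      by simp
    show "(\<lambda>n. norm ((\<Prod>k\<in>I n. char (\<nu> n k) u) - exp (log_char n u))) \<longlonglongrightarrow> 0"
      by (rule tendsto_norm_zero[OF prod_char_minus_exp_log_char])
  qed
  show ?thesis
  proof (intro iffI conjI)
    assume conv: "weak_conv_m \<mu> (translated_poisson b lam)"
    have lim: "(\<lambda>n. exp (\<i> * (u * A n) + log_char n u)) \<longlonglongrightarrow> exp (?\<psi> u)" for u
      using tendsto_diff[OF levy_continuity1[OF \<mu> P conv, of u] approx[of u]] by (simp add: char_P)
    have "Bseq total_variance"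
      using total_variance_tendsto convergent_def convergent_imp_Bseq by blast
    then obtain V where "\<And>n. norm (total_variance n) \<le> V"
      by (auto simp: Bseq_def)
    then have "(LINT x|\<mu> n. (x - A n)\<^sup>2) \<le> V" for n
      by (auto simp: var total_variance_def abs_le_iff)
    then obtain B where "\<forall>\<^sub>F n in sequentially. \<bar>A n\<bar> \<le> B"
      using weak_conv_imp_centering_bounded[OF \<mu> P conv int] by blast
    then obtain \<delta> where "0 < \<delta>" "A \<longlonglongrightarrow> b + lam"
        "\<And>u. \<bar>u\<bar> \<le> \<delta> \<Longrightarrow> (\<lambda>n. log_char n u) \<longlonglongrightarrow> lam * compensated_exp u 1"
      using exp_limit_imp_exponent_limit[of A B "b + lam"] lim by auto
    then show "A \<longlonglongrightarrow> b + lam" "\<forall>\<epsilon>>0. (\<lambda>n. off_one n \<epsilon>) \<longlonglongrightarrow> 0"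
      using off_one_tendsto_zero by auto
  next
    assume *: "A \<longlonglongrightarrow> b + lam \<and> (\<forall>\<epsilon>>0. (\<lambda>n. off_one n \<epsilon>) \<longlonglongrightarrow> 0)"
    show "weak_conv_m \<mu> (translated_poisson b lam)"
    proof (rule levy_continuity[OF \<mu> P])
      fix u
      have "(\<lambda>n. exp (\<i> * (u * A n) + log_char n u)) \<longlonglongrightarrow> exp (?\<psi> u)"
        using * by (intro tendsto_intros log_char_tendsto_poisson) auto
      from tendsto_add[OF approx[of u] this]
      show "(\<lambda>n. char (\<mu> n) u) \<longlonglongrightarrow> char (translated_poisson b lam) u"
        by (simp add: char_P)
    qed
  qed
qed

end

lemma (in prob_space) char_distr_shift:
  assumes [measurable]: "random_variable borel Y"
  shows "char (distr M borel (\<lambda>\<omega>. c + Y \<omega>)) u = exp (\<i> * (u * c)) * char (distr M borel Y) u"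
proof -
  have "char (distr M borel (\<lambda>\<omega>. c + Y \<omega>)) u = (CLINT \<omega>|M. iexp (u * (c + Y \<omega>)))"
    by (simp add: char_def integral_distr)
  also have "\<dots> = (CLINT \<omega>|M. exp (\<i> * (u * c)) * iexp (u * Y \<omega>))"
    by (intro Bochner_Integration.integral_cong refl) (simp add: exp_add[symmetric] algebra_simps)
  also have "\<dots> = exp (\<i> * (u * c)) * char (distr M borel Y) u"
    by (simp add: char_def integral_distr)
  finally show ?thesis .
qed

theorem theorem5:
  fixes M :: "nat \<Rightarrow> 'a measure"
    and X :: "nat \<Rightarrow> nat \<Rightarrow> 'a \<Rightarrow> real"
    and kn :: "nat \<Rightarrow> nat"
    and b lam :: real
  assumes prob: "\<And>n. n \<ge> 1 \<Longrightarrow> prob_space (M n)"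
    and kn_top: "filterlim kn at_top sequentially"
    and indep: "\<And>n. n \<ge> 1 \<Longrightarrow> prob_space.indep_vars (M n) (\<lambda>k. borel) (\<lambda>k. X k n) {1..kn n}"
    and square_integrable: "\<And>n k. n \<ge> 1 \<Longrightarrow> k \<in> {1..kn n} \<Longrightarrow> integrable (M n) (\<lambda>\<omega>. (X k n \<omega>)\<^sup>2)"
    and lambda_pos: "lam > 0"
    and max_var: "(\<lambda>n. Max ((\<lambda>k. prob_space.variance (M n) (X k n)) ` {1..kn n})) \<longlonglongrightarrow> 0"
    and sum_var: "(\<lambda>n. \<Sum>k=1..kn n. prob_space.variance (M n) (X k n)) \<longlonglongrightarrow> lam"
  shows "weak_conv_m (\<lambda>n. distr (M n) borel (\<lambda>\<omega>. \<Sum>k=1..kn n. X k n \<omega>)) (translated_poisson b lam)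
    \<longleftrightarrow> (\<lambda>n. \<Sum>k=1..kn n. prob_space.expectation (M n) (X k n)) \<longlonglongrightarrow> b + lam
      \<and> (\<forall>\<epsilon>>0. (\<lambda>n. g_pois M X kn n \<epsilon>) \<longlonglongrightarrow> 0)"
proof -
  define Y where "Y n k \<omega> = X k n \<omega> - prob_space.expectation (M n) (X k n)" for n k \<omega>
  define A where "A n = (\<Sum>k=1..kn n. prob_space.expectation (M n) (X k n))" for n
  define \<mu> where "\<mu> n = distr (M n) borel (\<lambda>\<omega>. \<Sum>k=1..kn n. X k n \<omega>)" for n
  define \<nu> where "\<nu> n k = distr (M n) borel (Y n k)" for n k
  define m where "m n = Max ((\<lambda>k. prob_space.variance (M n) (X k n)) ` {1..kn n})" for n

  have rv_X: "X k n \<in> borel_measurable (M n)" if "n \<ge> 1" "k \<in> {1..kn n}" for n k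
    using indep[OF that(1)] that(2) unfolding prob_space.indep_vars_def2[OF prob[OF that(1)]] by blast
  have rv_Y: "Y n k \<in> borel_measurable (M n)" if "n \<ge> 1" "k \<in> {1..kn n}" for n k
    using rv_X[OF that] unfolding Y_def[abs_def] by simp
  have int_X: "integrable (M n) (X k n)" if "n \<ge> 1" "k \<in> {1..kn n}" for n k
  proof -
    interpret prob_space "M n" by (rule prob[OF that(1)])
    show ?thesis using square_integrable_imp_integrable[OF rv_X square_integrable] that by blast
  qed
  have mean_Y: "(LINT \<omega>|M n. Y n k \<omega>) = 0" if "n \<ge> 1" "k \<in> {1..kn n}" for n k
  proof -
    interpret prob_space "M n" by (rule prob[OF that(1)])
    show ?thesis using int_X[OF that] by (simp add: Y_def prob_space)
  qed
  have sq_Y: "integrable (M n) (\<lambda>\<omega>. (Y n k \<omega>)\<^sup>2)" if "n \<ge> 1" "k \<in> {1..kn n}" for n k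
  proof -
    interpret prob_space "M n" by (rule prob[OF that(1)])
    show ?thesis using int_X[OF that] square_integrable[OF that] by (simp add: Y_def power2_diff)
  qed
  have distr_\<nu>: "real_distribution (\<nu> n k)" if "n \<ge> 1" "k \<in> {1..kn n}" for n k
    unfolding \<nu>_def by (rule prob_space.real_distribution_distr[OF prob[OF that(1)] rv_Y[OF that]])
  have moment_\<nu>: "(LINT x|\<nu> n k. x\<^sup>2) = (LINT \<omega>|M n. (Y n k \<omega>)\<^sup>2)" if "n \<ge> 1" "k \<in> {1..kn n}" for n k
    unfolding \<nu>_def using rv_Y[OF that] by (simp add: integral_distr)
  have variance_\<nu>: "(LINT x|\<nu> n k. x\<^sup>2) = prob_space.variance (M n) (X k n)"
    if "n \<ge> 1" "k \<in> {1..kn n}" for n k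
    unfolding moment_\<nu>[OF that] by (simp add: Y_def)

  \<comment> \<open>Nothing is assumed about row \<open>0\<close>, so the array is shifted by one; limits do not notice.\<close>
  interpret N: null_array "\<lambda>n. \<nu> (Suc n)" "\<lambda>n. {1..kn (Suc n)}" "\<lambda>n. m (Suc n)" lam
  proof (rule null_array.intro)
    show "(\<lambda>n. m (Suc n)) \<longlonglongrightarrow> 0"
      using LIMSEQ_Suc[OF max_var] by (simp add: m_def)
    have "(\<Sum>k=1..kn (Suc n). LINT x|\<nu> (Suc n) k. x\<^sup>2)
        = (\<Sum>k=1..kn (Suc n). prob_space.variance (M (Suc n)) (X k (Suc n)))" for n
      by (intro sum.cong refl variance_\<nu>) auto
    then show "(\<lambda>n. \<Sum>k=1..kn (Suc n). LINT x|\<nu> (Suc n) k. x\<^sup>2) \<longlonglongrightarrow> lam"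
      using LIMSEQ_Suc[OF sum_var] by simp
  next
    fix n k assume k: "k \<in> {1..kn (Suc n)}"
    show "real_distribution (\<nu> (Suc n) k)" using k by (intro distr_\<nu>) auto
    show "integrable (\<nu> (Suc n) k) (\<lambda>x. x\<^sup>2)"
      unfolding \<nu>_def using sq_Y[of "Suc n" k] rv_Y[of "Suc n" k] k by (simp add: integrable_distr_eq)
    show "(LINT x|\<nu> (Suc n) k. x) = 0"
      unfolding \<nu>_def using mean_Y[of "Suc n" k] rv_Y[of "Suc n" k] k by (simp add: integral_distr)
    show "(LINT x|\<nu> (Suc n) k. x\<^sup>2) \<le> m (Suc n)"
      unfolding variance_\<nu>[OF _ k, simplified] m_def using k by (intro Max_ge) auto
  qed simp

  have off_one: "N.off_one n \<epsilon> = g_pois M X kn (Suc n) \<epsilon>" for n \<epsilon>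
    unfolding N.off_one_def g_pois_def
  proof (rule sum.cong[OF refl])
    fix k assume "k \<in> {1..kn (Suc n)}"
    then have "interval_measure (centered_cdf (M (Suc n)) (X k (Suc n))) = \<nu> (Suc n) k"
      using real_distribution.interval_measure_cdf[OF distr_\<nu>, of "Suc n" k]
      by (simp add: centered_cdf_def \<nu>_def Y_def[abs_def])
    then show "(LINT x:{x. \<bar>x - 1\<bar> > \<epsilon>}|\<nu> (Suc n) k. x\<^sup>2)
        = (LINT x:{x. \<bar>x - 1\<bar> > \<epsilon>}|interval_measure (centered_cdf (M (Suc n)) (X k (Suc n))). x\<^sup>2)"
      by simp
  qed

  have "weak_conv_m (\<lambda>n. \<mu> (Suc n)) (translated_poisson b lam) \<longleftrightarrow>
    (\<lambda>n. A (Suc n)) \<longlonglongrightarrow> b + lam \<and> (\<forall>\<epsilon>>0. (\<lambda>n. N.off_one n \<epsilon>) \<longlonglongrightarrow> 0)"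
  proof (rule N.weak_conv_translated_poisson_iff[OF lambda_pos])
    fix n u
    interpret prob_space "M (Suc n)" by (rule prob) simp
    let ?I = "{1..kn (Suc n)}"
    let ?T = "\<lambda>\<omega>. \<Sum>k\<in>?I. Y (Suc n) k \<omega>"
    have S: "(\<lambda>\<omega>. \<Sum>k\<in>?I. X k (Suc n) \<omega>) = (\<lambda>\<omega>. A (Suc n) + ?T \<omega>)"
      by (simp add: A_def Y_def sum_subtractf)
    have [measurable]: "random_variable borel ?T"
      by (intro borel_measurable_sum rv_Y) auto
    have indep_Y: "indep_vars (\<lambda>_. borel) (Y (Suc n)) ?I"
      unfolding Y_def[abs_def] by (rule indep_vars_compose2[OF indep]) auto
    have T: "integrable (M (Suc n)) (\<lambda>\<omega>. (?T \<omega>)\<^sup>2)"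
        "expectation (\<lambda>\<omega>. (?T \<omega>)\<^sup>2) = (\<Sum>k\<in>?I. expectation (\<lambda>\<omega>. (Y (Suc n) k \<omega>)\<^sup>2))"
      by (intro expectation_square_sum_indep indep_Y sq_Y mean_Y; simp)+
    show "real_distribution (\<mu> (Suc n))"
      unfolding \<mu>_def S by (intro real_distribution_distr) (simp del: One_nat_def)
    show "char (\<mu> (Suc n)) u = exp (\<i> * (u * A (Suc n))) * (\<Prod>k\<in>?I. char (\<nu> (Suc n) k) u)"
      unfolding \<mu>_def S \<nu>_def by (simp del: One_nat_def add: char_distr_shift char_distr_sum[OF indep_Y])
    show "integrable (\<mu> (Suc n)) (\<lambda>x. (x - A (Suc n))\<^sup>2)"
      unfolding \<mu>_def S using T(1) by (simp del: One_nat_def add: integrable_distr_eq)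
    have "(LINT x|\<mu> (Suc n). (x - A (Suc n))\<^sup>2) = expectation (\<lambda>\<omega>. (?T \<omega>)\<^sup>2)"
      unfolding \<mu>_def S by (simp del: One_nat_def add: integral_distr)
    also have "\<dots> = (\<Sum>k\<in>?I. LINT x|\<nu> (Suc n) k. x\<^sup>2)"
      unfolding T(2) by (intro sum.cong refl moment_\<nu>[symmetric]) auto
    finally show "(LINT x|\<mu> (Suc n). (x - A (Suc n))\<^sup>2) = (\<Sum>k\<in>?I. LINT x|\<nu> (Suc n) k. x\<^sup>2)" .
  qed
  moreover have "weak_conv_m (\<lambda>n. \<mu> (Suc n)) (translated_poisson b lam) \<longleftrightarrow> weak_conv_m \<mu> (translated_poisson b lam)"
  proof -
    have "((\<lambda>n. cdf (\<mu> (Suc n)) x) \<longlonglongrightarrow> l) = ((\<lambda>n. cdf (\<mu> n) x) \<longlonglongrightarrow> l)" for x l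
      by (rule filterlim_sequentially_Suc)
    then show ?thesis by (simp only: weak_conv_m_def weak_conv_def)
  qed
  moreover have "(\<lambda>n. A (Suc n)) \<longlonglongrightarrow> b + lam \<longleftrightarrow> A \<longlonglongrightarrow> b + lam"
    by (rule filterlim_sequentially_Suc)
  moreover have "(\<lambda>n. N.off_one n \<epsilon>) \<longlonglongrightarrow> 0 \<longleftrightarrow> (\<lambda>n. g_pois M X kn n \<epsilon>) \<longlonglongrightarrow> 0" for \<epsilon>
    unfolding off_one by (rule filterlim_sequentially_Suc)
  ultimately show ?thesis
    by (simp add: \<mu>_def[abs_def] A_def[abs_def])
qed

end
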